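(* Let $(W,S)$ be a spherical Coxeter system (that is, $W$ is finite). Then $\mathcal{S}=\mathcal{E}=\Phi^+$.
   Context: Root system: $V$ is the real vector space with basis $\{\alpha_s\mid s\in S\}$ and form $\langle\alpha_s,\alpha_t\rangle=-\cos(\pi/m_{s,t})$, with $m_{s,t}$ the order of $st$; $W$ acts by $s\lambda=\lambda-2\langle\lambda,\alpha_s\rangle\alpha_s$; $\Phi=\{w\alpha_s\mid w\in W,s\in S\}$; $\Phi^+$ is the set of roots that are non-negative combinations of the $\alpha_s$ ($\alpha<0$ means $-\alpha\in\Phi^+$). $\Phi(w)=\{\alpha\in\Phi^+\mid w^{-1}\alpha<0\}$. A root $\beta\in\Phi^+$ dominates $\alpha\in\Phi^+$ if for all $w\in W$, $w^{-1}\beta<0$ implies $w^{-1}\alpha<0$; $\mathcal{E}$ is the set of elementary roots, i.e. those $\beta\in\Phi^+$ that dominate no $\alpha\in\Phi^+\setminus\{\beta\}$. $\mathcal{S}$ is the set of super-elementary roots, i.e. those $\beta\in\Phi^+$ for which there exist $x,y\in W$ with $\Phi(x)\cap\Phi(y)=\{\beta\}$. *)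

theory Defs
  imports Complex_Main "HOL-Algebra.Multiplicative_Group"
begin

section \<open>Coxeter systems\<close>

text \<open>The order of \<open>s \<otimes> t\<close>, where \<open>0\<close> (the value of \<^const>\<open>group.ord\<close> on elements of infinite
  order) stands for infinity.\<close>

definition cox_m :: "('a, 'b) monoid_scheme \<Rightarrow> 'a \<Rightarrow> 'a \<Rightarrow> nat" where
  "cox_m W s t = group.ord W (s \<otimes>\<^bsub>W\<^esub> t)"

definition word_prod :: "('a, 'b) monoid_scheme \<Rightarrow> 'a list \<Rightarrow> 'a" where
  "word_prod W ws = foldr (\<lambda>x y. x \<otimes>\<^bsub>W\<^esub> y) ws \<one>\<^bsub>W\<^esub>"

text \<open>The congruence on the free monoid over \<open>S\<close> generated by the Coxeter relations
  \<open>(st)\<^sup>m = 1\<close> with \<open>m = m\<^sub>s\<^sub>t\<close>.  The case \<open>s = t\<close> gives \<open>ss = 1\<close> (as \<open>m\<^sub>s\<^sub>s = 1\<close>), so inverse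
  letters are not needed and the quotient is the group presented by these relations;
  for \<open>m = 0\<close> (infinite order) the relation is trivial.\<close>

inductive cox_congr :: "('a, 'b) monoid_scheme \<Rightarrow> 'a set \<Rightarrow> 'a list \<Rightarrow> 'a list \<Rightarrow> bool"
  for W :: "('a, 'b) monoid_scheme" and S :: "'a set" where
  rel: "\<lbrakk>u \<in> lists S; v \<in> lists S; s \<in> S; t \<in> S\<rbrakk> \<Longrightarrow>
    cox_congr W S (u @ concat (replicate (cox_m W s t) [s, t]) @ v) (u @ v)"
| refl: "u \<in> lists S \<Longrightarrow> cox_congr W S u u"
| sym: "cox_congr W S u v \<Longrightarrow> cox_congr W S v u"
| trans: "\<lbrakk>cox_congr W S u v; cox_congr W S v w\<rbrakk> \<Longrightarrow> cox_congr W S u w"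

text \<open>The last assumption says that the Coxeter relations are defining relations: words
  with the same value in \<open>W\<close> are equal modulo these relations.\<close>

locale coxeter_system = group W for W (structure) +
  fixes S
  assumes S_subset: "S \<subseteq> carrier W"
    and S_order: "s \<in> S \<Longrightarrow> ord s = 2"
    and S_generates: "generate W S = carrier W"
    and presentation: "\<lbrakk>u \<in> lists S; v \<in> lists S; word_prod W u = word_prod W v\<rbrakk> \<Longrightarrow> cox_congr W S u v"

section \<open>Geometric representation and root system\<close>

context coxeter_system
begin

text \<open>\<open>V\<close> is the free real vector space on \<open>S\<close>: \<open>v s\<close> is the coefficient of \<open>v\<close> at the
  basis vector \<open>simple_root s\<close>.\<close>

definition V :: "('a \<Rightarrow> real) set" where
  "V = {v. finite {s. v s \<noteq> 0} \<and> {s. v s \<noteq> 0} \<subseteq> S}"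

definition simple_root :: "'a \<Rightarrow> 'a \<Rightarrow> real" where
  "simple_root s = (\<lambda>t. if t = s then 1 else 0)"

text \<open>If \<open>st\<close> has infinite order then \<open>pi / 0 = 0\<close>, so the value of the form on the simple roots
  at \<open>s\<close> and \<open>t\<close> is \<open>-1\<close>, which is the usual convention.\<close>

definition form :: "('a \<Rightarrow> real) \<Rightarrow> ('a \<Rightarrow> real) \<Rightarrow> real" where
  "form u v = (\<Sum>s | u s \<noteq> 0. \<Sum>t | v t \<noteq> 0. u s * v t * - cos (pi / real (cox_m W s t)))"

definition reflection :: "'a \<Rightarrow> ('a \<Rightarrow> real) \<Rightarrow> 'a \<Rightarrow> real" where
  "reflection s v = (\<lambda>t. v t - 2 * form v (simple_root s) * simple_root s t)"

text \<open>An element \<open>w = s\<^sub>1\<dots>s\<^sub>k\<close> acts on \<open>V\<close> as the composition of the reflections in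
  \<open>s\<^sub>1, \<dots>, s\<^sub>k\<close>; independence of the chosen word is \<open>act_word_prod\<close> below.\<close>

definition act :: "'a \<Rightarrow> ('a \<Rightarrow> real) \<Rightarrow> 'a \<Rightarrow> real" where
  "act w v = (THE u. \<exists>ws \<in> lists S. word_prod W ws = w \<and> u = foldr reflection ws v)"

definition roots :: "('a \<Rightarrow> real) set" where
  "roots = {act w (simple_root s) | w s. w \<in> carrier W \<and> s \<in> S}"

definition positive_roots :: "('a \<Rightarrow> real) set" where
  "positive_roots = {\<beta> \<in> roots. \<forall>s \<in> S. 0 \<le> \<beta> s}"

definition negative :: "('a \<Rightarrow> real) \<Rightarrow> bool" where
  "negative \<alpha> \<longleftrightarrow> - \<alpha> \<in> positive_roots"

definition inversion_set :: "'a \<Rightarrow> ('a \<Rightarrow> real) set" where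
  "inversion_set w = {\<alpha> \<in> positive_roots. negative (act (inv w) \<alpha>)}"

definition dominates :: "('a \<Rightarrow> real) \<Rightarrow> ('a \<Rightarrow> real) \<Rightarrow> bool" where
  "dominates \<beta> \<alpha> \<longleftrightarrow> \<beta> \<in> positive_roots \<and> \<alpha> \<in> positive_roots \<and>
     (\<forall>w \<in> carrier W. negative (act (inv w) \<beta>) \<longrightarrow> negative (act (inv w) \<alpha>))"

definition elementary_roots :: "('a \<Rightarrow> real) set" where
  "elementary_roots =
     {\<beta> \<in> positive_roots. \<not> (\<exists>\<alpha> \<in> positive_roots - {\<beta>}. dominates \<beta> \<alpha>)}"

definition super_elementary_roots :: "('a \<Rightarrow> real) set" where
  "super_elementary_roots =
     {\<beta> \<in> positive_roots. \<exists>x \<in> carrier W. \<exists>y \<in> carrier W.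
        inversion_set x \<inter> inversion_set y = {\<beta>}}"

end

subsection \<open>The action is well defined\<close>

context coxeter_system
begin

lemma S_square: "s \<in> S \<Longrightarrow> s \<otimes> s = \<one>"
  using pow_ord_eq_1[of s] S_order[of s] S_subset
  by (auto simp: numeral_2_eq_2)

lemma cox_m_same: "s \<in> S \<Longrightarrow> cox_m W s s = 1"
  using S_square[of s] by (simp add: cox_m_def)

lemma cox_m_eq_1: assumes "s \<in> S" "t \<in> S" "cox_m W s t = 1" shows "s = t"
proof -
  have c: "s \<in> carrier W" "t \<in> carrier W" using assms S_subset by auto
  have "s \<otimes> t = \<one>" using assms(3) c ord_eq_1[of "s \<otimes> t"] by (simp add: cox_m_def)
  then show ?thesis using S_square[OF assms(2)] c by (metis inv_equality)
qed

lemma cox_m_sym: assumes "s \<in> S" "t \<in> S" shows "cox_m W s t = cox_m W t s"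
proof -
  have c: "s \<in> carrier W" "t \<in> carrier W" using assms S_subset by auto
  have "inv s = s" "inv t = t" using S_square[OF assms(1)] S_square[OF assms(2)] c
    by (auto intro: inv_equality)
  then have "inv (s \<otimes> t) = t \<otimes> s" using c by (simp add: inv_mult_group)
  then show ?thesis using ord_inv[of "s \<otimes> t"] c by (simp add: cox_m_def)
qed

lemma form_simple_right:
  "form v (simple_root t) = (\<Sum>s | v s \<noteq> 0. v s * - cos (pi / real (cox_m W s t)))"
proof -
  have "{x. simple_root t x \<noteq> 0} = {t}" by (auto simp: simple_root_def)
  then show ?thesis by (simp add: form_def simple_root_def)
qed

lemma form_simple_sub:
  assumes "v \<in> V"
  shows "form (\<lambda>x. v x - c * simple_root r x) (simple_root t)
    = form v (simple_root t) + c * cos (pi / real (cox_m W r t))"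
proof -
  let ?A = "insert r {s. v s \<noteq> 0}"
  let ?g = "\<lambda>s. - cos (pi / real (cox_m W s t))"
  have f: "finite ?A" using assms by (simp add: V_def)
  have "form (\<lambda>x. v x - c * simple_root r x) (simple_root t)
     = (\<Sum>s\<in>?A. (v s - c * simple_root r s) * ?g s)"
    unfolding form_simple_right
    by (rule sum.mono_neutral_left[OF f]) (auto simp: simple_root_def)
  also have "\<dots> = (\<Sum>s\<in>?A. v s * ?g s) - (\<Sum>s\<in>?A. c * simple_root r s * ?g s)"
    unfolding sum_subtractf[symmetric] by (rule sum.cong) (auto simp: algebra_simps)
  also have "(\<Sum>s\<in>?A. v s * ?g s) = form v (simple_root t)"
    unfolding form_simple_right
    by (rule sum.mono_neutral_right[OF f]) auto
  also have "(\<Sum>s\<in>?A. c * simple_root r s * ?g s) = (\<Sum>s\<in>{r}. c * simple_root r s * ?g s)"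
    by (rule sum.mono_neutral_right[OF f]) (auto simp: simple_root_def)
  also have "\<dots> = c * ?g r" by (simp add: simple_root_def)
  finally show ?thesis by simp
qed

lemma sub_simple_V: "v \<in> V \<Longrightarrow> r \<in> S \<Longrightarrow> (\<lambda>x. v x - c * simple_root r x) \<in> V"
proof -
  assume v: "v \<in> V" and r: "r \<in> S"
  have sub: "{s. v s - c * simple_root r s \<noteq> 0} \<subseteq> insert r {s. v s \<noteq> 0}"
    by (auto simp: simple_root_def split: if_splits)
  then have "finite {s. v s - c * simple_root r s \<noteq> 0}"
    using v by (auto simp: V_def intro: finite_subset)
  then show ?thesis using v r sub by (auto simp: V_def)
qed

lemma reflection_V: "v \<in> V \<Longrightarrow> s \<in> S \<Longrightarrow> reflection s v \<in> V"
  unfolding reflection_def by (rule sub_simple_V)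

lemma simple_root_V: "s \<in> S \<Longrightarrow> simple_root s \<in> V"
proof -
  assume "s \<in> S"
  moreover have "{x. simple_root s x \<noteq> 0} = {s}" by (auto simp: simple_root_def)
  ultimately show ?thesis by (simp add: V_def)
qed

lemma foldr_reflection_V: "v \<in> V \<Longrightarrow> ws \<in> lists S \<Longrightarrow> foldr reflection ws v \<in> V"
  by (induction ws) (auto intro: reflection_V)

lemma form_reflection:
  assumes "v \<in> V"
  shows "form (reflection r v) (simple_root t)
    = form v (simple_root t) + 2 * form v (simple_root r) * cos (pi / real (cox_m W r t))"
  unfolding reflection_def using form_simple_sub[OF assms] by simp

lemma reflection_twice:
  assumes "v \<in> V" "s \<in> S" shows "reflection s (reflection s v) = v"
proof -
  have "form (reflection s v) (simple_root s) = - form v (simple_root s)"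
    using form_reflection[OF assms(1), of s s] cox_m_same[OF assms(2)] by simp
  then show ?thesis by (subst reflection_def) (simp add: reflection_def)
qed

lemma reflection_relation:
  assumes v: "v \<in> V" and s: "s \<in> S" and t: "t \<in> S"
  shows "((\<lambda>x. reflection s (reflection t x)) ^^ cox_m W s t) v = v"
proof -
  define m where "m = cox_m W s t"
  consider "m = 0" | "m = 1" | "2 \<le> m" by linarith
  then show ?thesis
  proof cases
    case 1 then show ?thesis by (simp add: m_def)
  next
    case 2
    then have "s = t" using cox_m_eq_1[OF s t] unfolding m_def by simp
    then show ?thesis using 2 reflection_twice[OF v s] by (simp add: m_def)
  next
    case 3
    define h where "h = pi / real m"
    define f where "f = (\<lambda>x. reflection s (reflection t x))"
    define a where "a = (\<lambda>n. form ((f ^^ n) v) (simple_root s))"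
    define b where "b = (\<lambda>n. form ((f ^^ n) v) (simple_root t))"
    have hpos: "0 < h" "h < pi" using 3 by (auto simp: h_def field_simps)
    have sinpos: "sin h > 0" using hpos by (rule sin_gt_zero)
    have st: "cos (pi / real (cox_m W s t)) = cos h" "cos (pi / real (cox_m W t s)) = cos h"
      "cos (pi / real (cox_m W s s)) = -1" "cos (pi / real (cox_m W t t)) = -1"
      using cox_m_sym[OF s t] cox_m_same[OF s] cox_m_same[OF t] by (auto simp: h_def m_def)
    have inV: "(f ^^ n) v \<in> V" for n
      by (induction n) (auto simp: v f_def intro!: reflection_V s t)
    have a_Suc: "a (Suc n) = - (a n + 2 * b n * cos h)" for n
      using form_reflection[OF reflection_V[OF inV[of n] t], of s s]
        form_reflection[OF inV[of n], of t s] st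
      by (simp add: a_def b_def f_def)
    have b_Suc: "b (Suc n) = - b n + 2 * (a n + 2 * b n * cos h) * cos h" for n
      using form_reflection[OF reflection_V[OF inV[of n] t], of s t]
        form_reflection[OF inV[of n], of t s] form_reflection[OF inV[of n], of t t] st
      by (simp add: a_def b_def f_def)
    have closed: "a n * sin h = - a 0 * sin ((2 * real n - 1) * h) - b 0 * sin (2 * real n * h)
        \<and> b n * sin h = a 0 * sin (2 * real n * h) + b 0 * sin ((2 * real n + 1) * h)" for n
    proof (induction n)
      case 0 then show ?case by simp
    next
      case (Suc n)
      have rec: "sin (x + 2 * h) = 2 * cos h * sin (x + h) - sin x" for x
      proof -
        have arg: "x + 2 * h = (x + h) + h" "(x + h) - h = x" by simp_all
        have "2 * cos h * sin (x + h) = sin (x + h) * cos h + sin (x + h) * cos h" by simp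
        then show ?thesis
          using sin_diff[of "x + h" h] unfolding arg(2) unfolding arg(1) sin_add[of "x + h" h]
          by linarith
      qed
      have alg1: "- (- a' * x - b' * k) - 2 * c * (a' * k + b' * y) = - a' * y - b' * z"
        if "y = 2 * c * k - x" "z = 2 * c * y - k" for a' b' c x y z k :: real
        unfolding that(2) that(1) by (simp add: algebra_simps)
      have alg2: "- (a' * k + b' * y) - 2 * c * (- a' * y - b' * z) = a' * z + b' * w"
        if "z = 2 * c * y - k" "w = 2 * c * z - y" for a' b' c w y z k :: real
        unfolding that(2) that(1) by (simp add: algebra_simps)
      let ?k = "2 * real n * h"
      have e: "(2 * real n - 1) * h = ?k - h" "(2 * real n + 1) * h = ?k + h"
        "2 * real (Suc n) * h = ?k + 2 * h" "(2 * real (Suc n) - 1) * h = ?k + h"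
        "(2 * real (Suc n) + 1) * h = (?k + h) + 2 * h"
        by (simp_all add: algebra_simps)
      have r1: "sin (?k + h) = 2 * cos h * sin ?k - sin (?k - h)"
        using rec[of "?k - h"] by (simp add: algebra_simps)
      have r2: "sin (?k + 2 * h) = 2 * cos h * sin (?k + h) - sin ?k" by (rule rec)
      have r3: "sin (?k + h + 2 * h) = 2 * cos h * sin (?k + 2 * h) - sin (?k + h)"
        using rec[of "?k + h"] by (simp add: algebra_simps)
      have A: "a n * sin h = - a 0 * sin (?k - h) - b 0 * sin ?k"
        and B: "b n * sin h = a 0 * sin ?k + b 0 * sin (?k + h)"
        using Suc e(1,2) by auto
      have "a (Suc n) * sin h = - (a n * sin h) - 2 * cos h * (b n * sin h)"
        by (simp add: a_Suc algebra_simps)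
      also have "\<dots> = - a 0 * sin (?k + h) - b 0 * sin (?k + 2 * h)"
        unfolding A B by (rule alg1[OF r1 r2])
      finally have A': "a (Suc n) * sin h = - a 0 * sin (?k + h) - b 0 * sin (?k + 2 * h)" .
      have "b (Suc n) * sin h = - (b n * sin h) - 2 * cos h * (a (Suc n) * sin h)"
        by (simp add: a_Suc b_Suc algebra_simps)
      also have "\<dots> = a 0 * sin (?k + 2 * h) + b 0 * sin (?k + h + 2 * h)"
        unfolding A' B by (rule alg2[OF r2 r3])
      finally show ?case using A' e by simp
    qed
    have span: "\<exists>p q. (f ^^ n) v = (\<lambda>x. v x - p * simple_root s x - q * simple_root t x)" for n
    proof (induction n)
      case 0 show ?case by (rule exI[of _ 0], rule exI[of _ 0]) simp
    next
      case (Suc n)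
      then obtain p q where pq:
        "(f ^^ n) v = (\<lambda>x. v x - p * simple_root s x - q * simple_root t x)" by blast
      have "\<exists>c d. f w = (\<lambda>x. w x - c * simple_root s x - d * simple_root t x)" for w
        unfolding f_def
        by (rule exI[of _ "2 * form (reflection t w) (simple_root s)"],
            rule exI[of _ "2 * form w (simple_root t)"], subst reflection_def) (simp add: reflection_def algebra_simps)
      then obtain c d where
        "f ((f ^^ n) v) = (\<lambda>x. (f ^^ n) v x - c * simple_root s x - d * simple_root t x)" by blast
      then have "(f ^^ Suc n) v
          = (\<lambda>x. v x - (p + c) * simple_root s x - (q + d) * simple_root t x)"
        by (simp add: pq algebra_simps)
      then show ?case by blast
    qed
    then obtain p q where pq:
      "(f ^^ m) v = (\<lambda>x. v x - p * simple_root s x - q * simple_root t x)" by blast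
    have mh: "real m * h = pi" using 3 by (simp add: h_def)
    have "(2 * real m - 1) * h = 2 * pi - h" "2 * real m * h = 2 * pi"
      "(2 * real m + 1) * h = h + 2 * pi"
      using mh by (simp_all add: algebra_simps)
    then have "sin ((2 * real m - 1) * h) = - sin h" "sin (2 * real m * h) = 0"
      "sin ((2 * real m + 1) * h) = sin h"
      by (simp_all only: sin_diff sin_periodic) simp_all
    then have "a m * sin h = a 0 * sin h" "b m * sin h = b 0 * sin h"
      using closed[of m] by simp_all
    then have "a m = a 0" "b m = b 0" using sinpos by simp_all
    moreover have "a m = a 0 - p + q * cos h" "b m = b 0 + p * cos h - q"
      using form_simple_sub[OF v, of p s]
        form_simple_sub[OF sub_simple_V[OF v s], of p q t s] st
        form_simple_sub[OF sub_simple_V[OF v s], of p q t t]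
      by (simp_all add: a_def b_def pq)
    ultimately have 1: "p = q * cos h" "q = p * cos h" by simp_all
    have "p * (1 - (cos h)\<^sup>2) = 0" using 1 by (simp add: algebra_simps power2_eq_square)
    then have "p * (sin h)\<^sup>2 = 0" by (simp add: sin_squared_eq)
    then have "p = 0" using sinpos by simp
    then have "q = 0" using 1(2) by simp
    show ?thesis using pq \<open>p = 0\<close> \<open>q = 0\<close> by (simp add: f_def m_def)
  qed
qed

lemma foldr_relation:
  "foldr reflection (concat (replicate n [s, t])) v
    = ((\<lambda>x. reflection s (reflection t x)) ^^ n) v"
  by (induction n) auto

lemma cox_congr_foldr_reflection:
  assumes "cox_congr W S u w" and "v \<in> V"
  shows "foldr reflection u v = foldr reflection w v"
  using assms
proof (induction arbitrary: v rule: cox_congr.induct)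
  case (rel u w s t)
  then show ?case
    using reflection_relation[OF foldr_reflection_V[OF rel.prems rel.hyps(2)]]
    by (simp add: foldr_relation)
qed auto

lemma word_prod_closed: "ws \<in> lists S \<Longrightarrow> word_prod W ws \<in> carrier W"
  using S_subset by (induction ws) (auto simp: word_prod_def)

lemma word_prod_append:
  assumes "u \<in> lists S" "v \<in> lists S"
  shows "word_prod W (u @ v) = word_prod W u \<otimes> word_prod W v"
  using assms(1)
proof (induction u)
  case Nil
  then show ?case using word_prod_closed[OF assms(2)] by (simp add: word_prod_def)
next
  case (Cons a u)
  have "a \<in> carrier W" using Cons.hyps(1) S_subset by auto
  then have "a \<otimes> (word_prod W u \<otimes> word_prod W v) = a \<otimes> word_prod W u \<otimes> word_prod W v"
    using word_prod_closed Cons.hyps(2) assms(2) by (simp add: m_assoc)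
  then show ?case using Cons.IH by (simp add: word_prod_def)
qed

lemma word_exists:
  assumes "w \<in> carrier W" shows "\<exists>ws \<in> lists S. word_prod W ws = w"
proof -
  have "w \<in> generate W S" using assms S_generates by simp
  then show ?thesis
  proof (induction rule: generate.induct)
    case one show ?case by (rule bexI[of _ "[]"]) (auto simp: word_prod_def)
  next
    case (incl h)
    then show ?case using S_subset by (intro bexI[of _ "[h]"]) (auto simp: word_prod_def)
  next
    case (inv h)
    then have "h \<in> carrier W" using S_subset by auto
    moreover have "inv h = h" using S_square[OF inv] \<open>h \<in> carrier W\<close> by (auto intro: inv_equality)
    ultimately show ?case using inv by (intro bexI[of _ "[h]"]) (auto simp: word_prod_def)
  next
    case (eng h1 h2)
    then obtain u v where "u \<in> lists S" "word_prod W u = h1" "v \<in> lists S" "word_prod W v = h2"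
      by auto
    then show ?case using word_prod_append[of u v] by (intro bexI[of _ "u @ v"]) auto
  qed
qed

theorem act_word_prod:
  assumes "v \<in> V" "ws \<in> lists S"
  shows "act (word_prod W ws) v = foldr reflection ws v"
  unfolding act_def
proof (rule the_equality)
  show "\<exists>ws'\<in>lists S. word_prod W ws' = word_prod W ws \<and>
      foldr reflection ws v = foldr reflection ws' v"
    using assms by blast
next
  fix u assume "\<exists>ws'\<in>lists S. word_prod W ws' = word_prod W ws \<and> u = foldr reflection ws' v"
  then show "u = foldr reflection ws v"
    using presentation[of _ ws] cox_congr_foldr_reflection assms by metis
qed

corollary act_simple: "v \<in> V \<Longrightarrow> s \<in> S \<Longrightarrow> act s v = reflection s v"
  using act_word_prod[of v "[s]"] S_subset by (auto simp: word_prod_def)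

corollary act_one: "v \<in> V \<Longrightarrow> act \<one> v = v"
  using act_word_prod[of v "[]"] by (simp add: word_prod_def)

corollary act_mult:
  assumes "v \<in> V" "g \<in> carrier W" "h \<in> carrier W"
  shows "act (g \<otimes> h) v = act g (act h v)"
proof -
  obtain u w where u: "u \<in> lists S" "word_prod W u = g" and w: "w \<in> lists S" "word_prod W w = h"
    using word_exists assms by metis
  have "u @ w \<in> lists S" using u w by simp
  then have "act (g \<otimes> h) v = foldr reflection (u @ w) v"
    using act_word_prod[OF assms(1), of "u @ w"] word_prod_append[OF u(1) w(1)] u w by simp
  also have "\<dots> = act g (foldr reflection w v)"
    using act_word_prod[OF foldr_reflection_V[OF assms(1) w(1)] u(1)] u by simp
  also have "foldr reflection w v = act h v" using act_word_prod[OF assms(1) w(1)] w by simp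
  finally show ?thesis .
qed

end

end

theory Submission
  imports Defs
begin

text \<open>Write a positive root as \<open>\<beta> = w \<alpha>\<^sub>s\<close> and let \<open>w\<^sub>0\<close> be an element of maximal length.  Every root is
  positive or negative, and \<open>w\<^sub>0\<close> sends every positive root to a negative one, so
  \<open>\<Phi>(w w\<^sub>0\<inverse>)\<close> is the complement of \<open>\<Phi>(w)\<close> in \<open>\<Phi>\<^sup>+\<close>.  As \<open>\<alpha>\<^sub>s\<close> is the only positive root that
  \<open>s\<close> makes negative, \<open>\<Phi>(w s)\<close> meets this complement exactly in \<open>\<beta>\<close>; so \<open>\<beta>\<close> is super-elementary.
  If \<open>\<Phi>(x) \<inter> \<Phi>(y) = {\<beta>}\<close>, a root dominated by \<open>\<beta>\<close> lies in both sets and hence equals \<open>\<beta>\<close>.\<close>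

section \<open>Length\<close>

context coxeter_system
begin

definition len :: "'a \<Rightarrow> nat" where
  "len w = (LEAST n. \<exists>ws \<in> lists S. word_prod W ws = w \<and> length ws = n)"

lemma len_le: "ws \<in> lists S \<Longrightarrow> len (word_prod W ws) \<le> length ws"
  unfolding len_def by (rule Least_le) blast

lemma reduced_word_exists:
  assumes "w \<in> carrier W"
  obtains ws where "ws \<in> lists S" "word_prod W ws = w" "length ws = len w"
proof -
  have "\<exists>n. \<exists>ws \<in> lists S. word_prod W ws = w \<and> length ws = n"
    using word_exists[OF assms] by blast
  then have "\<exists>ws \<in> lists S. word_prod W ws = w \<and> length ws = len w"
    unfolding len_def by (rule LeastI_ex)
  then show ?thesis using that by blast
qed

lemma word_prod_Nil [simp]: "word_prod W [] = \<one>"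
  by (simp add: word_prod_def)

lemma word_prod_Cons [simp]: "word_prod W (a # u) = a \<otimes> word_prod W u"
  by (simp add: word_prod_def)

lemma word_prod_snoc:
  assumes "u \<in> lists S" "s \<in> S"
  shows "word_prod W (u @ [s]) = word_prod W u \<otimes> s"
  using word_prod_append[of u "[s]"] assms S_subset by auto

lemma S_carrier: "s \<in> S \<Longrightarrow> s \<in> carrier W"
  using S_subset by blast

lemma mult_S_cancel: "w \<in> carrier W \<Longrightarrow> s \<in> S \<Longrightarrow> w \<otimes> s \<otimes> s = w"
  by (simp add: m_assoc S_carrier S_square)

lemma inv_S: "s \<in> S \<Longrightarrow> inv s = s"
  by (simp add: S_square S_carrier inv_equality)

lemma rev_in_lists [simp]: "rev u \<in> lists A \<longleftrightarrow> u \<in> lists A"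
  by (simp add: in_lists_conv_set)

lemma word_prod_rev:
  assumes "u \<in> lists S"
  shows "word_prod W (rev u) = inv (word_prod W u)"
  using assms
proof (induction u)
  case (Cons a u)
  have "word_prod W (rev (a # u)) = word_prod W (rev u) \<otimes> a"
    using word_prod_snoc[of "rev u" a] Cons.hyps by simp
  then show ?case
    using Cons word_prod_closed[of u] by (simp add: inv_mult_group S_carrier inv_S)
qed simp

lemma len_mult_le:
  assumes "g \<in> carrier W" "h \<in> carrier W"
  shows "len (g \<otimes> h) \<le> len g + len h"
proof -
  obtain u v where u: "u \<in> lists S" "word_prod W u = g" "length u = len g"
    and v: "v \<in> lists S" "word_prod W v = h" "length v = len h"
    using reduced_word_exists assms by metis
  show ?thesis using len_le[of "u @ v"] word_prod_append[of u v] u v by simp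
qed

lemma len_S_le: "s \<in> S \<Longrightarrow> len s \<le> 1"
  using len_le[of "[s]"] by (simp add: S_carrier)

lemma len_mult_S_le: "w \<in> carrier W \<Longrightarrow> s \<in> S \<Longrightarrow> len (w \<otimes> s) \<le> len w + 1"
  using len_mult_le[of w s] len_S_le[of s] by (simp add: S_carrier)

text \<open>Every relator is a power of a two-letter word, so inserting or deleting it changes the
  length by an even number. This is the sign character, read off from words.\<close>

lemma cox_congr_even_length:
  "cox_congr W S u v \<Longrightarrow> even (length u) \<longleftrightarrow> even (length v)"
proof (induction rule: cox_congr.induct)
  case (rel u v s t)
  have "length (concat (replicate n [s, t])) = 2 * n" for n by (induction n) auto
  then show ?case by simp
qed auto

text \<open>A reduced word of \<open>w\<close> followed by \<open>s\<close> and a reduced word of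
  \<open>w \<otimes> s\<close> have the same value, so their lengths have the same parity.\<close>

lemma len_mult_S_neq:
  assumes "w \<in> carrier W" "s \<in> S"
  shows "len (w \<otimes> s) \<noteq> len w"
proof -
  obtain u where u: "u \<in> lists S" "word_prod W u = w" "length u = len w"
    using reduced_word_exists assms by metis
  obtain v where v: "v \<in> lists S" "word_prod W v = w \<otimes> s" "length v = len (w \<otimes> s)"
    using reduced_word_exists assms S_carrier m_closed by metis
  have "cox_congr W S (u @ [s]) v"
    using presentation[of "u @ [s]" v] u v assms word_prod_snoc[of u s] by simp
  then show ?thesis using cox_congr_even_length u v by fastforce
qed

section \<open>Right descents and cosets of the subgroup generated by two simple reflections\<close>

lemma len_mult_S_cases:
  assumes "w \<in> carrier W" "s \<in> S"
  obtains "len (w \<otimes> s) = len w + 1" | "len w = len (w \<otimes> s) + 1"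
  using len_mult_S_neq[OF assms] len_mult_S_le[OF assms]
    len_mult_S_le[of "w \<otimes> s" s] mult_S_cancel[OF assms] assms S_carrier
  by fastforce

lemma descent_exists:
  assumes "w \<in> carrier W" "len w \<noteq> 0"
  obtains t where "t \<in> S" "len (w \<otimes> t) < len w"
proof -
  obtain u where u: "u \<in> lists S" "word_prod W u = w" "length u = len w"
    using reduced_word_exists assms by metis
  then obtain u' t where ut: "u = u' @ [t]" using assms by (cases u rule: rev_cases) auto
  then have t: "t \<in> S" and u': "u' \<in> lists S" using u by auto
  have "w = word_prod W u' \<otimes> t" using word_prod_snoc[OF u' t] u ut by simp
  then have "w \<otimes> t = word_prod W u'" using mult_S_cancel word_prod_closed t u' by metis
  then have "len (w \<otimes> t) < len w" using len_le[OF u'] u ut by simp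
  then show ?thesis using that t by blast
qed

text \<open>Right descents in \<open>{s, t}\<close> are stripped off one at a time until none is
  left; the removed letters form \<open>u\<close>, and \<open>v\<close> is what remains of the coset
  of \<open>w\<close>.\<close>

lemma dihedral_factorization:
  assumes "w \<in> carrier W" "s \<in> S" "t \<in> S"
  obtains v u where "v \<in> carrier W" "u \<in> lists {s, t}" "w = v \<otimes> word_prod W u"
    "len w = len v + length u" "len v < len (v \<otimes> s)" "len v < len (v \<otimes> t)"
proof -
  have "\<exists>v u. v \<in> carrier W \<and> u \<in> lists {s, t} \<and> w = v \<otimes> word_prod W u \<and>
    len w = len v + length u \<and> len v < len (v \<otimes> s) \<and> len v < len (v \<otimes> t)"
    using assms(1)
  proof (induction "len w" arbitrary: w rule: less_induct)
    case less
    show ?case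
    proof (cases "\<exists>r \<in> {s, t}. len (w \<otimes> r) < len w")
      case True
      then obtain r where r: "r \<in> {s, t}" "len (w \<otimes> r) < len w" by blast
      then have rS: "r \<in> S" using assms by auto
      have wr: "w \<otimes> r \<in> carrier W" using less.prems rS S_carrier by simp
      obtain v u where vu: "v \<in> carrier W" "u \<in> lists {s, t}" "w \<otimes> r = v \<otimes> word_prod W u"
        "len (w \<otimes> r) = len v + length u" "len v < len (v \<otimes> s)" "len v < len (v \<otimes> t)"
        using less.hyps[OF r(2) wr] by blast
      have uS: "u \<in> lists S" using vu(2) assms by auto
      have "w = w \<otimes> r \<otimes> r" using mult_S_cancel less.prems rS by simp
      also have "\<dots> = v \<otimes> word_prod W (u @ [r])"
        using vu word_prod_snoc[OF uS rS] word_prod_closed[OF uS] S_carrier[OF rS]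
        by (simp add: m_assoc)
      finally have "w = v \<otimes> word_prod W (u @ [r])" .
      \<comment> \<open>A descent lowers the length by exactly one, so the lengths still add
        up.\<close>
      moreover have "len w = len v + length (u @ [r])"
        using vu(4) r(2) by (cases rule: len_mult_S_cases[OF less.prems rS]) auto
      moreover have "u @ [r] \<in> lists {s, t}" using vu(2) r(1) by auto
      ultimately show ?thesis using vu by blast
    next
      case False
      then have "len w < len (w \<otimes> s)" "len w < len (w \<otimes> t)"
        using len_mult_S_neq[OF less.prems] assms by (metis insertCI linorder_neqE_nat)+
      then show ?thesis using less.prems by (intro exI[of _ w] exI[of _ "[]"]) auto
    qed
  qed
  then show ?thesis using that by blast
qed

section \<open>Alternating words\<close>

fun alt_word :: "nat \<Rightarrow> 'a \<Rightarrow> 'a \<Rightarrow> 'a list" where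
  "alt_word 0 a b = []"
| "alt_word (Suc k) a b = a # alt_word k b a"

lemma length_alt_word [simp]: "length (alt_word k a b) = k"
  by (induction k arbitrary: a b) auto

lemma alt_word_lists: "a \<in> S \<Longrightarrow> b \<in> S \<Longrightarrow> alt_word k a b \<in> lists S"
  by (induction k arbitrary: a b) auto

lemma alt_word_even: "alt_word (2 * n) a b = concat (replicate n [a, b])"
  by (induction n) auto

lemma take_alt_word: "j \<le> k \<Longrightarrow> take j (alt_word k a b) = alt_word j a b"
proof (induction k arbitrary: j a b)
  case (Suc k)
  then show ?case by (cases j) auto
qed simp

lemma word_prod_relation:
  assumes "a \<in> S" "b \<in> S"
  shows "word_prod W (alt_word (2 * cox_m W a b) a b) = \<one>"
proof -
  have c: "a \<in> carrier W" "b \<in> carrier W" using assms S_carrier by auto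
  have "word_prod W (concat (replicate n [a, b])) = (a \<otimes> b) [^] n" for n
  proof (induction n)
    case (Suc n)
    have "word_prod W (concat (replicate (Suc n) [a, b])) = (a \<otimes> b) \<otimes> (a \<otimes> b) [^] n"
      using Suc c by (simp add: m_assoc)
    then show ?case using c nat_pow_Suc2[of "a \<otimes> b" n] by simp
  qed simp
  then show ?thesis using c unfolding alt_word_even cox_m_def by simp
qed

text \<open>With \<open>m = cox_m W a b\<close>, the relator of length \<open>2 * m\<close> splits
  into \<open>x\<close> with \<open>m + 1\<close> letters and \<open>y\<close> with
  \<open>m - 1\<close>. Hence \<open>x\<close> has the value of the reversed \<open>y\<close>, and
  this replacement of the prefix \<open>x\<close> shortens the word by two letters.\<close>

lemma len_alt_word_lt:
  assumes "a \<in> S" "b \<in> S" "cox_m W a b > 0" "cox_m W a b < n"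
  shows "len (word_prod W (alt_word n a b)) < n"
proof -
  define m where "m = cox_m W a b"
  define x where "x = alt_word (m + 1) a b"
  define y where "y = drop (m + 1) (alt_word (2 * m) a b)"
  define z where "z = drop (m + 1) (alt_word n a b)"
  have "x @ y = alt_word (2 * m) a b"
    using take_alt_word[of "m + 1" "2 * m" a b] assms(3) append_take_drop_id
    unfolding x_def y_def m_def by (metis Suc_eq_plus1 Suc_leI add_strict_left_mono mult_2 nat_arith.rule0)
  moreover have S: "alt_word k a b \<in> lists S" for k using alt_word_lists assms by blast
  ultimately have xyS: "x \<in> lists S" "y \<in> lists S" using append_in_lists_conv by metis+
  have "x @ z = alt_word n a b"
    using take_alt_word[of "m + 1" n a b] assms(4) append_take_drop_id
    unfolding x_def z_def m_def by (metis Suc_eq_plus1 Suc_leI)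
  then have zS: "z \<in> lists S" and xz: "word_prod W (alt_word n a b) = word_prod W x \<otimes> word_prod W z"
    using S append_in_lists_conv word_prod_append by metis+
  have "word_prod W x \<otimes> word_prod W y = \<one>"
    using word_prod_relation[OF assms(1,2)] word_prod_append[OF xyS] \<open>x @ y = _\<close> m_def by simp
  then have "word_prod W x = word_prod W (rev y)"
    using word_prod_rev[OF xyS(2)] word_prod_closed[OF xyS(1)] word_prod_closed[OF xyS(2)]
      inv_equality by metis
  then have "len (word_prod W x) \<le> length y" using len_le[of "rev y"] xyS by simp
  then show ?thesis
    using len_mult_le[OF word_prod_closed[OF xyS(1)] word_prod_closed[OF zS]] len_le[OF zS] xz assms(3,4)
    by (simp add: y_def z_def m_def)
qed

text \<open>Two equal neighbouring letters would cancel and give a shorter word.\<close>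

lemma reduced_dihedral_alternating:
  assumes "u \<in> lists {s, t}" "s \<in> S" "t \<in> S" "len (word_prod W u) = length u" "u \<noteq> []"
  obtains a b where "{a, b} = {s, t}" "u = alt_word (length u) a b"
proof -
  have "\<exists>a b. {a, b} = {s, t} \<and> u = alt_word (length u) a b"
    using assms(1,4,5)
  proof (induction u rule: list.induct)
    case (Cons x u)
    have xS: "x \<in> S" and uS: "u \<in> lists S" using Cons.prems(1) assms(2,3) by auto
    \<comment> \<open>The tail of a reduced word is reduced, which the induction hypothesis
      requires.\<close>
    have "length u + 1 \<le> 1 + len (word_prod W u)"
      using len_mult_le[OF S_carrier[OF xS] word_prod_closed[OF uS]] len_S_le[OF xS] Cons.prems(2) by simp
    then have red: "len (word_prod W u) = length u" using len_le[OF uS] by simp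
    show ?case
    proof (cases u)
      case Nil
      \<comment> \<open>The second letter does not occur in a one-letter word; it is chosen to
        complete the pair to \<open>{s, t}\<close>.\<close>
      then show ?thesis using Cons.prems(1) by (intro exI[of _ x] exI[of _ "if x = s then t else s"]) auto
    next
      case (Cons y u')
      then obtain a b where ab: "{a, b} = {s, t}" "u = alt_word (length u) a b"
        using Cons.IH[OF _ red] Cons.prems(1) by auto
      have "y = a" using ab(2) Cons by simp
      have "x \<noteq> a"
      proof
        assume "x = a"
        have u'S: "u' \<in> lists S" using Cons uS by simp
        have "word_prod W (x # u) = (a \<otimes> a) \<otimes> word_prod W u'"
          using Cons \<open>x = a\<close> \<open>y = a\<close> xS word_prod_closed[OF u'S] S_carrier by (simp add: m_assoc)
        then have "word_prod W (x # u) = word_prod W u'"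
          using S_square xS \<open>x = a\<close> word_prod_closed[OF u'S] by simp
        then show False using len_le[OF u'S] Cons.prems(2) Cons by simp
      qed
      then have "x = b" using ab(1) Cons.prems(1) by auto
      then show ?thesis using ab by (intro exI[of _ b] exI[of _ a]) auto
    qed
  qed simp
  then show ?thesis using that by blast
qed

end

section \<open>The form and the action\<close>

locale finite_coxeter_system = coxeter_system +
  assumes finite_carrier: "finite (carrier W)"
begin

lemma finite_S: "finite S"
  using finite_carrier S_subset by (rule finite_subset[rotated])

text \<open>As \<open>S\<close> is finite, the finiteness of the support is automatic.\<close>

lemma V_iff: "v \<in> V \<longleftrightarrow> (\<forall>s. s \<notin> S \<longrightarrow> v s = 0)"
  using finite_S by (auto simp: V_def intro: finite_subset)

lemma form_V:
  assumes "u \<in> V" "v \<in> V"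
  shows "form u v = (\<Sum>s\<in>S. \<Sum>t\<in>S. u s * v t * - cos (pi / real (cox_m W s t)))"
proof -
  have "form u v = (\<Sum>s | u s \<noteq> 0. \<Sum>t\<in>S. u s * v t * - cos (pi / real (cox_m W s t)))"
    unfolding form_def
    by (intro sum.cong refl sum.mono_neutral_left finite_S) (use assms in \<open>auto simp: V_def\<close>)
  also have "\<dots> = (\<Sum>s\<in>S. \<Sum>t\<in>S. u s * v t * - cos (pi / real (cox_m W s t)))"
    by (intro sum.mono_neutral_left finite_S) (use assms in \<open>auto simp: V_def\<close>)
  finally show ?thesis .
qed

lemma comb_V: "u \<in> V \<Longrightarrow> v \<in> V \<Longrightarrow> (\<lambda>x. c * u x + d * v x) \<in> V"
  by (simp add: V_iff)

lemma form_comb_left: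
  assumes "u \<in> V" "v \<in> V" "z \<in> V"
  shows "form (\<lambda>x. c * u x + d * v x) z = c * form u z + d * form v z"
  unfolding form_V[OF comb_V[OF assms(1,2)] assms(3)] form_V[OF assms(1,3)] form_V[OF assms(2,3)]
  by (simp add: sum_distrib_left sum.distrib[symmetric] sum_subtractf[symmetric] algebra_simps)

lemma form_sym:
  assumes "u \<in> V" "v \<in> V"
  shows "form u v = form v u"
proof -
  have "form u v = (\<Sum>t\<in>S. \<Sum>s\<in>S. u s * v t * - cos (pi / real (cox_m W s t)))"
    unfolding form_V[OF assms] by (rule sum.swap)
  also have "\<dots> = form v u"
    unfolding form_V[OF assms(2,1)] by (intro sum.cong) (simp_all add: cox_m_sym)
  finally show ?thesis .
qed

lemma form_simple_same: "s \<in> S \<Longrightarrow> form (simple_root s) (simple_root s) = 1"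
proof -
  assume s: "s \<in> S"
  have "{x. simple_root s x \<noteq> 0} = {s}" "simple_root s s = 1" by (auto simp: simple_root_def)
  then show ?thesis by (simp add: form_simple_right cox_m_same[OF s])
qed

lemma reflection_comb:
  assumes "s \<in> S" "u \<in> V" "v \<in> V"
  shows "reflection s (\<lambda>x. c * u x + d * v x) = (\<lambda>x. c * reflection s u x + d * reflection s v x)"
  unfolding reflection_def form_comb_left[OF assms(2,3) simple_root_V[OF assms(1)]]
  by (simp add: algebra_simps)

text \<open>The cross terms cancel because the simple root has norm 1. Invariance of the form
  carries this norm over to all roots.\<close>

lemma form_reflection_reflection:
  assumes s: "s \<in> S" and u: "u \<in> V" and v: "v \<in> V"
  shows "form (reflection s u) (reflection s v) = form u v"
proof -
  let ?a = "simple_root s"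
  have a: "?a \<in> V" using simple_root_V s by simp
  have r: "reflection s z = (\<lambda>x. 1 * z x + (- 2 * form z ?a) * ?a x)" for z
    by (simp add: reflection_def)
  have left: "form (reflection s z) y = form z y - 2 * form z ?a * form ?a y"
    if "z \<in> V" "y \<in> V" for z y
    unfolding r form_comb_left[OF that(1) a that(2)] by simp
  have rv: "reflection s v \<in> V" using reflection_V s v by simp
  have "form u (reflection s v) = form u v - 2 * form v ?a * form ?a u"
    "form ?a (reflection s v) = form v ?a - 2 * form v ?a * form ?a ?a"
    using left[OF v u] left[OF v a] form_sym[OF u rv] form_sym[OF a rv] form_sym[OF u v] by simp_all
  then show ?thesis
    using left[OF u rv] form_simple_same[OF s] form_sym[OF u a] by simp
qed

section \<open>Linearity of the action and invariance of the form\<close>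

lemma act_V:
  assumes "w \<in> carrier W" "v \<in> V"
  shows "act w v \<in> V"
proof -
  obtain ws where ws: "ws \<in> lists S" "word_prod W ws = w" using word_exists assms by blast
  then show ?thesis
    using act_word_prod[OF assms(2) ws(1)] foldr_reflection_V[OF assms(2) ws(1)] by simp
qed

lemma act_comb:
  assumes "w \<in> carrier W" "u \<in> V" "v \<in> V"
  shows "act w (\<lambda>x. c * u x + d * v x) = (\<lambda>x. c * act w u x + d * act w v x)"
proof -
  obtain ws where ws: "ws \<in> lists S" "word_prod W ws = w" using word_exists assms by blast
  have "foldr reflection ws (\<lambda>x. c * u x + d * v x)
      = (\<lambda>x. c * foldr reflection ws u x + d * foldr reflection ws v x)"
    using ws(1)
    by (induction ws) (simp_all add: reflection_comb foldr_reflection_V assms)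
  then show ?thesis
    using act_word_prod[OF comb_V[OF assms(2,3)] ws(1)] act_word_prod[OF assms(2) ws(1)]
      act_word_prod[OF assms(3) ws(1)] ws(2) by simp
qed

lemma act_uminus:
  assumes "w \<in> carrier W" "v \<in> V"
  shows "act w (- v) = - act w v"
proof -
  have "- v = (\<lambda>x. (-1) * v x + 0 * v x)" by auto
  then show ?thesis using act_comb[OF assms(1,2,2), of "-1" 0] by auto
qed

lemma act_inv_act:
  assumes "w \<in> carrier W" "v \<in> V"
  shows "act (inv w) (act w v) = v" "act w (act (inv w) v) = v"
  using act_mult[of v "inv w" w] act_mult[of v w "inv w"] act_one assms by simp_all

lemma form_act:
  assumes "w \<in> carrier W" "u \<in> V" "v \<in> V"
  shows "form (act w u) (act w v) = form u v"
proof -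
  obtain ws where ws: "ws \<in> lists S" "word_prod W ws = w" using word_exists assms by blast
  have "form (foldr reflection ws u) (foldr reflection ws v) = form u v"
    using ws(1)
    by (induction ws) (simp_all add: form_reflection_reflection foldr_reflection_V assms)
  then show ?thesis using act_word_prod[OF _ ws(1)] assms ws(2) by simp
qed

section \<open>Positive and negative roots\<close>

text \<open>Finiteness of the group excludes the value 0, which encodes infinite order.\<close>

lemma cox_m_ge_2:
  assumes "s \<in> S" "t \<in> S" "s \<noteq> t"
  shows "2 \<le> cox_m W s t"
proof -
  have "cox_m W s t \<ge> 1"
    unfolding cox_m_def using ord_ge_1[OF finite_carrier] assms S_carrier by simp
  moreover have "cox_m W s t \<noteq> 1" using cox_m_eq_1 assms by blast
  ultimately show ?thesis by simp
qed

text \<open>In the plane of two simple roots, each further reflection advances the coefficients by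
  one step of the recurrence for \<open>sin (k * h)\<close>. The last letter \<open>x\<close>
  supplies the root, the letters before it act.\<close>

lemma foldr_reflection_alt_word:
  assumes "a \<in> S" "b \<in> S" "a \<noteq> b" "alt_word (Suc k) a b = u @ [x]"
  defines "h \<equiv> pi / real (cox_m W a b)"
  shows "foldr reflection u (simple_root x) =
    (\<lambda>y. sin (real (Suc k) * h) / sin h * simple_root a y + sin (real k * h) / sin h * simple_root b y)"
proof -
  have m: "2 \<le> cox_m W a b" using cox_m_ge_2 assms by blast
  have hpos: "0 < h" "h < pi" using m by (auto simp: h_def field_simps)
  have sinpos: "sin h > 0" using hpos by (rule sin_gt_zero)
  \<comment> \<open>The pair of letters is generalized because removing the first letter swaps their
    roles; the angle \<open>h\<close> is symmetric in them.\<close>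
  have "a' \<in> S \<Longrightarrow> b' \<in> S \<Longrightarrow> a' \<noteq> b' \<Longrightarrow> pi / real (cox_m W a' b') = h \<Longrightarrow>
    alt_word (Suc k) a' b' = u @ [x] \<Longrightarrow>
    foldr reflection u (simple_root x) = (\<lambda>y. sin (real (Suc k) * h) / sin h * simple_root a' y
      + sin (real k * h) / sin h * simple_root b' y)" for a' b'
  proof (induction k arbitrary: a' b' u)
    case 0
    then show ?case using sinpos by simp
  next
    case (Suc k)
    obtain u' where u: "u = a' # u'" and u': "alt_word (Suc k) b' a' = u' @ [x]"
      using Suc.prems(5) by (cases u) auto
    have hb: "pi / real (cox_m W b' a') = h" using Suc.prems cox_m_sym by simp
    have Va: "simple_root a' \<in> V" "simple_root b' \<in> V" using Suc.prems simple_root_V by auto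
    have f: "form (simple_root a') (simple_root a') = 1"
      "form (simple_root b') (simple_root a') = - cos h"
    proof -
      have "{x. simple_root b' x \<noteq> 0} = {b'}" "simple_root b' b' = 1"
        by (auto simp: simple_root_def)
      then show "form (simple_root b') (simple_root a') = - cos h"
        using hb by (simp add: form_simple_right)
    qed (use form_simple_same Suc.prems in auto)
    \<comment> \<open>The sum of \<open>sin (y + h)\<close> and \<open>sin (y - h)\<close> is
      \<open>2 * cos h * sin y\<close>. The right-hand side is, up to the factor
      \<open>sin h\<close>, the coefficient at \<open>a'\<close> after the reflection in
      \<open>a'\<close>.\<close>
    have rec: "sin (real (Suc (Suc k)) * h) = 2 * cos h * sin (real (Suc k) * h) - sin (real k * h)"
    proof -
      have "real (Suc (Suc k)) * h = real (Suc k) * h + h" "real k * h = real (Suc k) * h - h"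
        by (simp_all add: algebra_simps)
      then show ?thesis by (simp only: sin_add sin_diff) simp
    qed
    have "foldr reflection u (simple_root x) =
      reflection a' (\<lambda>y. sin (real (Suc k) * h) / sin h * simple_root b' y
        + sin (real k * h) / sin h * simple_root a' y)"
      using Suc.IH[OF Suc.prems(2,1) _ hb u'] Suc.prems(3) u by simp
    also have "\<dots> = (\<lambda>y. sin (real (Suc (Suc k)) * h) / sin h * simple_root a' y
      + sin (real (Suc k) * h) / sin h * simple_root b' y)"
      unfolding reflection_comb[OF Suc.prems(1) Va(2,1)]
      unfolding reflection_def f rec
      using sinpos by (auto simp: field_simps)
    finally show ?case .
  qed
  then show ?thesis using assms by simp
qed

text \<open>With a descent \<open>t\<close> of \<open>w\<close>, split \<open>w = v u\<close> with \<open>u\<close> a word in \<open>s, t\<close> and \<open>v\<close> without descents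
  in \<open>{s, t}\<close>.  Then \<open>u s\<close> is reduced, hence alternating of length at most \<open>m\<^sub>s\<^sub>t\<close>, which keeps the
  arguments of the sines in the coefficients of \<open>u \<alpha>\<^sub>s\<close> within \<open>[0, \<pi>]\<close>; induction applies to \<open>v\<close>.\<close>

lemma act_simple_root_nonneg:
  assumes "w \<in> carrier W" "s \<in> S" "len w < len (w \<otimes> s)"
  shows "0 \<le> act w (simple_root s) r"
  using assms
proof (induction "len w" arbitrary: w s rule: less_induct)
  case less
  note w = less.prems(1) and s = less.prems(2)
  show ?case
  proof (cases "len w = 0")
    case True
    then have "w = \<one>" using reduced_word_exists[OF w] by fastforce
    then show ?thesis using act_one simple_root_V[OF s] by (simp add: simple_root_def)
  next
    case False
    then obtain t where t: "t \<in> S" "len (w \<otimes> t) < len w" using descent_exists w by blast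
    have st: "s \<noteq> t" using t less.prems by auto
    obtain v u where vu: "v \<in> carrier W" "u \<in> lists {s, t}" "w = v \<otimes> word_prod W u"
      "len w = len v + length u" "len v < len (v \<otimes> s)" "len v < len (v \<otimes> t)"
      using dihedral_factorization[OF w s t(1)] by blast
    have uS: "u \<in> lists S" using vu(2) s t by auto
    \<comment> \<open>Otherwise \<open>w = v\<close>, but \<open>t\<close> is a descent of
      \<open>w\<close> and not of \<open>v\<close>.\<close>
    have "u \<noteq> []" using vu(1,3,6) t(2) by auto
    then have lv: "len v < len w" using vu(4) by simp
    have IH: "0 \<le> act v (simple_root x) r" if "x \<in> {s, t}" for x
      using that less.hyps[OF lv vu(1)] s t(1) vu(5,6) by blast
    have us: "u @ [s] \<in> lists S" using uS s by simp
    have "w \<otimes> s = v \<otimes> word_prod W (u @ [s])"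
      using word_prod_snoc[OF uS s] vu(1,3) word_prod_closed[OF uS] S_carrier[OF s]
      by (simp add: m_assoc)
    then have "len (w \<otimes> s) \<le> len v + len (word_prod W (u @ [s]))"
      using len_mult_le[OF vu(1) word_prod_closed[OF us]] by simp
    \<comment> \<open>The ascent gives \<open>len (w \<otimes> s) > len v + length u\<close>, so the
      factor of value \<open>word_prod W (u @ [s])\<close> must have length at least
      \<open>length u + 1\<close>.\<close>
    then have red: "len (word_prod W (u @ [s])) = length (u @ [s])"
      using less.prems(3) vu(4) len_le[OF us] by simp
    obtain a b where ab: "{a, b} = {s, t}" "u @ [s] = alt_word (length (u @ [s])) a b"
      using reduced_dihedral_alternating[OF _ s t(1) red] vu(2) by auto
    let ?k = "length u"
    define h where "h = pi / real (cox_m W a b)"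
    have abS: "a \<in> S" "b \<in> S" "a \<noteq> b" using ab(1) s t(1) st by (auto simp: doubleton_eq_iff)
    have m: "2 \<le> cox_m W a b" using cox_m_ge_2[OF abS] .
    have km: "Suc ?k \<le> cox_m W a b"
      using len_alt_word_lt[OF abS(1,2), of "Suc ?k"] m red ab(2)
      by (metis length_append_singleton less_irrefl not_le not_numeral_le_zero gr0I)
    have h: "0 < h" "real (cox_m W a b) * h = pi" using m by (simp_all add: h_def)
    have nonneg: "0 \<le> sin (real j * h) / sin h" if "j \<le> cox_m W a b" for j
    proof -
      have "real j * h \<le> pi" using h that by (metis less_imp_le mult_right_mono of_nat_le_iff)
      \<comment> \<open>This puts \<open>h\<close> itself in the interval where the sine, here the
        denominator, is non-negative.\<close>
      moreover have "1 * h \<le> pi" unfolding h(2)[symmetric] using m h by (intro mult_right_mono) auto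
      ultimately show ?thesis using h(1) by (intro divide_nonneg_nonneg sin_ge_zero) auto
    qed
    have V: "simple_root a \<in> V" "simple_root b \<in> V" "simple_root s \<in> V"
      using abS s simple_root_V by auto
    have "act w (simple_root s) = act v (foldr reflection u (simple_root s))"
      using act_mult[OF V(3) vu(1) word_prod_closed[OF uS]] act_word_prod[OF V(3) uS] vu(3) by simp
    also have "foldr reflection u (simple_root s) = (\<lambda>y. sin (real (Suc ?k) * h) / sin h * simple_root a y
        + sin (real ?k * h) / sin h * simple_root b y)"
      unfolding h_def by (rule foldr_reflection_alt_word[OF abS]) (use ab(2) in simp)
    also have "act v \<dots> = (\<lambda>y. sin (real (Suc ?k) * h) / sin h * act v (simple_root a) y
        + sin (real ?k * h) / sin h * act v (simple_root b) y)"
      by (rule act_comb[OF vu(1) V(1,2)])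
    finally have "act w (simple_root s) r = sin (real (Suc ?k) * h) / sin h * act v (simple_root a) r
        + sin (real ?k * h) / sin h * act v (simple_root b) r"
      by (rule fun_cong)
    moreover have "0 \<le> act v (simple_root a) r" "0 \<le> act v (simple_root b) r"
      using IH ab(1) by blast+
    ultimately show ?thesis
      using nonneg[of "Suc ?k"] nonneg[of ?k] km
      by (metis Suc_leD add_nonneg_nonneg mult_nonneg_nonneg)
  qed
qed

section \<open>Signs of roots\<close>

lemma reflection_simple_root: "s \<in> S \<Longrightarrow> reflection s (simple_root s) = - simple_root s"
  by (auto simp: reflection_def form_simple_same)

lemma act_mult_simple_root:
  assumes "w \<in> carrier W" "s \<in> S"
  shows "act (w \<otimes> s) (simple_root s) = - act w (simple_root s)"
  using assms act_mult[of "simple_root s" w s] act_simple[of "simple_root s" s]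
  by (simp add: simple_root_V S_carrier reflection_simple_root act_uminus)

text \<open>If \<open>s\<close> is a descent of \<open>w\<close>, it is an ascent of
  \<open>w \<otimes> s\<close>, and the two elements send the simple root to opposite
  vectors.\<close>

lemma act_simple_root_nonpos:
  assumes "w \<in> carrier W" "s \<in> S" "len (w \<otimes> s) < len w"
  shows "act w (simple_root s) r \<le> 0"
  using act_simple_root_nonneg[of "w \<otimes> s" s r] assms mult_S_cancel[OF assms(1,2)]
    act_mult_simple_root[OF assms(1,2)] by (simp add: S_carrier)

lemma root_V: "\<gamma> \<in> roots \<Longrightarrow> \<gamma> \<in> V"
  by (auto simp: roots_def intro!: act_V simple_root_V)

lemma act_root: "w \<in> carrier W \<Longrightarrow> \<gamma> \<in> roots \<Longrightarrow> act w \<gamma> \<in> roots"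
  unfolding roots_def using act_mult[OF simple_root_V, symmetric] m_closed by fastforce

lemma uminus_root: "\<gamma> \<in> roots \<Longrightarrow> - \<gamma> \<in> roots"
  unfolding roots_def using act_mult_simple_root[symmetric] S_carrier m_closed by fastforce

lemma simple_root_positive: "s \<in> S \<Longrightarrow> simple_root s \<in> positive_roots"
  using act_one[OF simple_root_V] unfolding positive_roots_def roots_def
  by (force simp: simple_root_def)

lemma form_root: "\<gamma> \<in> roots \<Longrightarrow> form \<gamma> \<gamma> = 1"
  by (auto simp: roots_def form_act simple_root_V form_simple_same)

text \<open>Lengths of \<open>w\<close> and \<open>w \<otimes> s\<close> never agree, so one of the
  two sign lemmas applies.\<close>

lemma root_cases:
  assumes "\<gamma> \<in> roots"
  shows "\<gamma> \<in> positive_roots \<or> negative \<gamma>"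
proof -
  obtain w s where ws: "w \<in> carrier W" "s \<in> S" "\<gamma> = act w (simple_root s)"
    using assms by (auto simp: roots_def)
  show ?thesis
    using assms uminus_root[OF assms] act_simple_root_nonneg[OF ws(1,2)] act_simple_root_nonpos[OF ws(1,2)]
      len_mult_S_neq[OF ws(1,2)] ws(3)
    by (auto simp: positive_roots_def negative_def linorder_neq_iff)
qed

text \<open>A root of both signs would be the zero vector, but roots have norm 1.\<close>

lemma positive_not_negative:
  assumes "\<gamma> \<in> positive_roots"
  shows "\<not> negative \<gamma>"
proof
  assume "negative \<gamma>"
  then have "\<gamma> s = 0" for s
    using assms root_V[of \<gamma>] V_iff
    by (cases "s \<in> S") (force simp: positive_roots_def negative_def)+
  then have "form \<gamma> \<gamma> = 0" by (simp add: form_def)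
  then show False using form_root assms by (simp add: positive_roots_def)
qed

text \<open>Reflection in \<open>s\<close> changes only the coefficient at \<open>s\<close>, so all
  other coefficients are both non-negative and non-positive. A non-negative multiple of the simple
  root with norm 1 is the simple root itself.\<close>

lemma reflection_negative:
  assumes "s \<in> S" "\<gamma> \<in> positive_roots" "negative (reflection s \<gamma>)"
  shows "\<gamma> = simple_root s"
proof -
  have g: "\<gamma> \<in> roots" "\<gamma> \<in> V" using assms(2) root_V by (auto simp: positive_roots_def)
  have z: "\<gamma> t = 0" if "t \<noteq> s" for t
  proof (cases "t \<in> S")
    case True
    then have "0 \<le> \<gamma> t" using assms(2) by (simp add: positive_roots_def)
    moreover have "0 \<le> - reflection s \<gamma> t"
      using assms(3) True by (simp add: negative_def positive_roots_def)
    then have "\<gamma> t \<le> 0" using that by (simp add: reflection_def simple_root_def)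
    ultimately show ?thesis by simp
  qed (use g V_iff in auto)
  have a: "simple_root s \<in> V" using simple_root_V assms(1) by simp
  define c where "c = \<gamma> s"
  \<comment> \<open>The zero summand brings the multiple into the shape that
    \<open>form_comb_left\<close> expects.\<close>
  have eq: "(\<lambda>x. c * simple_root s x + 0 * simple_root s x) = \<gamma>"
    using z by (auto simp: simple_root_def c_def)
  have "form \<gamma> v = c * form (simple_root s) v" if "v \<in> V" for v
    using form_comb_left[OF a a that, of c 0] unfolding eq by simp
  then have "form \<gamma> \<gamma> = c * (c * form (simple_root s) (simple_root s))"
    using g(2) a form_sym[OF g(2) a] by metis
  then have "c * c = 1" using form_root[OF g(1)] form_simple_same[OF assms(1)] by simp
  moreover have "0 \<le> c" using assms by (simp add: positive_roots_def c_def)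
  ultimately have "c = 1" by (simp add: square_eq_1_iff)
  then show ?thesis using eq by simp
qed

text \<open>An element of maximal length has every simple reflection as a descent, so it sends all
  simple roots to non-positive vectors; linearity extends this to all non-negative
  combinations.\<close>

lemma longest_element:
  obtains w0 where "w0 \<in> carrier W" "\<And>\<gamma>. \<gamma> \<in> positive_roots \<Longrightarrow> negative (act w0 \<gamma>)"
proof -
  have "Max (len ` carrier W) \<in> len ` carrier W"
    using finite_carrier by (intro Max_in) auto
  then obtain w0 where w0: "w0 \<in> carrier W" "len w0 = Max (len ` carrier W)" by auto
  then have max: "len w \<le> len w0" if "w \<in> carrier W" for w
    using that finite_carrier by simp
  have simp_le: "act w0 (simple_root s) r \<le> 0" if "s \<in> S" for s r
    using act_simple_root_nonpos[OF w0(1) that] len_mult_S_neq[OF w0(1) that] max[of "w0 \<otimes> s"]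
      w0(1) S_carrier[OF that] by simp
  \<comment> \<open>Stated for arbitrary non-negative vectors, since removing one coefficient from a
    root need not leave a root. The induction runs over a finite set containing the support.\<close>
  have le: "act w0 v r \<le> 0" if "finite F" "F \<subseteq> S" "\<forall>s. s \<notin> F \<longrightarrow> v s = 0" "\<forall>s. 0 \<le> v s" for F v r
    using that
  proof (induction F arbitrary: v rule: finite_induct)
    case empty
    then have eq: "v = (\<lambda>x. 0 * v x + 0 * v x)" and vV: "v \<in> V" by (auto simp: V_iff)
    then show ?case using act_comb[OF w0(1) vV vV, of 0 0] by simp
  next
    case (insert s F)
    define u where "u = v(s := 0)"
    have s: "s \<in> S" using insert.prems by simp
    have uV: "u \<in> V" using insert.prems by (auto simp: u_def V_iff)
    have "v = (\<lambda>x. v s * simple_root s x + 1 * u x)" by (auto simp: u_def simple_root_def)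
    then have "act w0 v = (\<lambda>x. v s * act w0 (simple_root s) x + 1 * act w0 u x)"
      using act_comb[OF w0(1) simple_root_V[OF s] uV, of "v s" 1] by simp
    moreover have "act w0 u r \<le> 0"
      by (rule insert.IH) (use insert.prems in \<open>auto simp: u_def\<close>)
    moreover have "v s * act w0 (simple_root s) r \<le> 0"
      using mult_nonneg_nonpos[OF _ simp_le[OF s]] insert.prems(3) by blast
    ultimately show ?case by simp
  qed
  have "negative (act w0 \<gamma>)" if "\<gamma> \<in> positive_roots" for \<gamma>
  proof -
    have g: "\<gamma> \<in> roots" "\<forall>s\<in>S. 0 \<le> \<gamma> s" "\<gamma> \<in> V"
      using that root_V by (auto simp: positive_roots_def)
    have "0 \<le> \<gamma> s" for s using g V_iff[of \<gamma>] by (cases "s \<in> S") auto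
    then have "act w0 \<gamma> r \<le> 0" for r using le[OF finite_S, of \<gamma> r] g V_iff[of \<gamma>] by blast
    then show ?thesis
      using uminus_root[OF act_root[OF w0(1) g(1)]] by (simp add: negative_def positive_roots_def)
  qed
  then show ?thesis using that w0(1) by blast
qed

section \<open>Super-elementary roots\<close>

lemma positive_root_super_elementary:
  assumes "\<beta> \<in> positive_roots"
  shows "\<beta> \<in> super_elementary_roots"
proof -
  obtain w s where w: "w \<in> carrier W" and s: "s \<in> S" and b: "\<beta> = act w (simple_root s)"
    using assms by (auto simp: positive_roots_def roots_def)
  obtain w0 where w0: "w0 \<in> carrier W" "\<And>\<gamma>. \<gamma> \<in> positive_roots \<Longrightarrow> negative (act w0 \<gamma>)"
    using longest_element by blast
  have sW: "s \<in> carrier W" using s S_carrier by simp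
  have wb: "act (inv w) \<beta> = simple_root s"
    using act_inv_act(1)[OF w simple_root_V[OF s]] b by simp
  \<comment> \<open>Both inversion sets are pulled back along \<open>w\<close>: membership of
    \<open>\<gamma>\<close> becomes a condition on the signs of \<open>s\<close> and
    \<open>w0\<close> applied to \<open>act (inv w) \<gamma>\<close>.\<close>
  have x: "act (inv (w \<otimes> s)) \<gamma> = reflection s (act (inv w) \<gamma>)" if "\<gamma> \<in> V" for \<gamma>
    using act_mult[OF that sW, of "inv w"] act_simple[OF act_V[OF _ that] s] w s sW
    by (simp add: inv_mult_group inv_S)
  have y: "act (inv (w \<otimes> inv w0)) \<gamma> = act w0 (act (inv w) \<gamma>)" if "\<gamma> \<in> V" for \<gamma>
    using act_mult[OF that w0(1), of "inv w"] w w0(1) by (simp add: inv_mult_group)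
  have "\<gamma> = \<beta>" if "\<gamma> \<in> inversion_set (w \<otimes> s)" "\<gamma> \<in> inversion_set (w \<otimes> inv w0)" for \<gamma>
  proof -
    define \<delta> where "\<delta> = act (inv w) \<gamma>"
    have g: "\<gamma> \<in> roots" "\<gamma> \<in> V"
      using that(1) root_V by (auto simp: inversion_set_def positive_roots_def)
    have d: "\<delta> \<in> roots" "\<delta> \<in> V" using act_root[OF _ g(1)] act_V[OF _ g(2)] w \<delta>_def by auto
    have "negative (reflection s \<delta>)" "negative (act w0 \<delta>)"
      using that x[OF g(2)] y[OF g(2)] by (simp_all add: inversion_set_def \<delta>_def)
    \<comment> \<open>If \<open>\<delta>\<close> were negative, \<open>w0\<close> would send it to a
      positive root.\<close>
    have "\<not> negative \<delta>"
    proof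
      assume "negative \<delta>"
      then have "negative (- act w0 \<delta>)"
        using w0(2)[of "- \<delta>"] act_uminus[OF w0(1) d(2)] by (simp add: negative_def)
      then show False
        using positive_not_negative[of "- act w0 \<delta>"] \<open>negative (act w0 \<delta>)\<close>
        by (simp add: negative_def)
    qed
    then have "\<delta> = simple_root s"
      using root_cases[OF d(1)] reflection_negative[OF s] \<open>negative (reflection s \<delta>)\<close> by blast
    then show ?thesis using act_inv_act(2)[OF w g(2)] b \<delta>_def by simp
  qed
  moreover have "\<beta> \<in> V" using assms root_V by (simp add: positive_roots_def)
  \<comment> \<open>The pullback of \<open>\<beta>\<close> is the simple root of \<open>s\<close>,
    which both \<open>s\<close> and \<open>w0\<close> make negative.\<close>
  then have "\<beta> \<in> inversion_set (w \<otimes> s)" "\<beta> \<in> inversion_set (w \<otimes> inv w0)"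
    using x y wb assms reflection_simple_root[OF s] w0(2) simple_root_positive[OF s]
    by (simp_all add: inversion_set_def negative_def fun_Compl_def)
  ultimately have "inversion_set (w \<otimes> s) \<inter> inversion_set (w \<otimes> inv w0) = {\<beta>}" by blast
  then show ?thesis
    using assms w w0(1) sW unfolding super_elementary_roots_def by blast
qed

end

lemma (in coxeter_system) super_elementary_imp_elementary:
  "super_elementary_roots \<subseteq> elementary_roots"
  unfolding super_elementary_roots_def elementary_roots_def dominates_def inversion_set_def
  by blast

theorem theorem7p3:
  fixes W :: "('a, 'b) monoid_scheme" and S :: "'a set"
  assumes "coxeter_system W S"
    and "finite (carrier W)"
  shows "coxeter_system.super_elementary_roots W S = coxeter_system.elementary_roots W S \<and>
    coxeter_system.elementary_roots W S = coxeter_system.positive_roots W S"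
proof -
  interpret finite_coxeter_system W S
    using assms by (simp add: finite_coxeter_system_def finite_coxeter_system_axioms_def)
  have "elementary_roots \<subseteq> positive_roots" by (auto simp: elementary_roots_def)
  then show ?thesis
    using super_elementary_imp_elementary positive_root_super_elementary by blast
qed

end
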